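(* Let $\Phi'\subseteq\Phi\subseteq BC_n$ be nested root systems, regarded in $V^\vee$ with $V=\mathbb{C}^n$, and let $U=\bigcap_{\alpha\in\Phi'}\mathrm{Ker}(\alpha)\subseteq V$. Then the hyperplane arrangement $\{\mathrm{Ker}(\alpha|_U) : \alpha\in\Phi\setminus\Phi',\ \alpha|_U\ne0\}$ in $U$ of the restricted system is isomorphic to a direct sum of hyperplane arrangements each of which is either of classical type, or of "exotic" type $(B_r/C_r)D_{r+s}$, for integers $r,s\geq0$ with $r+s\leq n$.
   Context: Let $(e_i)$ be the canonical basis of $V=\mathbb{C}^n$, $\alpha_i=e_i^\vee$ the dual basis of $V^\vee$, with the scalar product on $V^\vee$ making it orthonormal. $BC_n=\{\pm\alpha_i\pm\alpha_j: i\ne j\}\cup\{\pm\alpha_i,\pm2\alpha_i\}\subseteq V^\vee$. A root subsystem of $BC_n$ is a subset $\Phi$ stable under the orthogonal reflections defined by its elements; "nested root systems $\Phi'\subseteq\Phi\subseteq BC_n$" means both are root subsystems of $BC_n$. A hyperplane arrangement in a finite-dimensional complex vector space is a finite set of linear hyperplanes. Two arrangements are isomorphic if a linear isomorphism of the ambient spaces carries one onto the other. The direct sum of arrangements $\mathcal{H}_1$ in $V_1$ and $\mathcal{H}_2$ in $V_2$ is the arrangement in $V_1\oplus V_2$ consisting of the hyperplanes $H_1\oplus V_2$ ($H_1\in\mathcal{H}_1$) and $V_1\oplus H_2$ ($H_2\in\mathcal{H}_2$); the empty direct sum is the empty arrangement in $0$. Arrangements in $\mathbb{C}^m$ ($m\ge1$),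 with coordinates $z_1,\dots,z_m$, of classical type: type $A_{m-1}$: $\{z_i-z_j=0\}$, $i\ne j$; type $D_m$: $\{z_i\pm z_j=0\}$, $i\neq j$; type $B_m/C_m$ (equivalently $BC_m$): $\{z_i\pm z_j=0\}$, $i\ne j$, together with $\{z_i=0\}$, $1\le i\le m$. The arrangement of type $(B_r/C_r)D_{r+s}$ in $\mathbb{C}^{r+s}$ consists of $\{z_i\pm z_j=0\}$ for $i\ne j\in\{1,\dots,r+s\}$ and $\{z_i=0\}$ for $i\in\{1,\dots,r\}$. *)

theory Defs
  imports Complex_Main "HOL-Library.Function_Algebras"
begin

section \<open>Complex vector spaces of functions\<close>

text \<open>
  All vector spaces are linear subspaces of some \<open>'a \<Rightarrow> complex\<close> with pointwise operations, so that
  spaces of different and varying dimensions can be treated together.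
\<close>

definition scale_fun :: "complex \<Rightarrow> ('a \<Rightarrow> complex) \<Rightarrow> 'a \<Rightarrow> complex" (infixr \<open>*\<^sub>F\<close> 75)
  where "c *\<^sub>F v = (\<lambda>x. c * v x)"

interpretation fun_vs: vector_space scale_fun
  by unfold_locales (auto simp: scale_fun_def fun_eq_iff algebra_simps)

definition Cn :: "nat \<Rightarrow> (nat \<Rightarrow> complex) set"
  where "Cn n = {v. \<forall>i\<ge>n. v i = 0}"

text \<open>
  Linear forms on a subspace \<open>W\<close> are represented by functions that vanish outside \<open>W\<close>; equality,
  addition and scaling in the dual space are then just those of functions.
\<close>

definition dual_space :: "('a \<Rightarrow> complex) set \<Rightarrow> (('a \<Rightarrow> complex) \<Rightarrow> complex) set"
  where "dual_space W = {f. (\<forall>u\<in>W. \<forall>v\<in>W. f (u + v) = f u + f v) \<and>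
                            (\<forall>c. \<forall>v\<in>W. f (c *\<^sub>F v) = c * f v) \<and> (\<forall>v. v \<notin> W \<longrightarrow> f v = 0)}"

definition restrict_form ::
    "(('a \<Rightarrow> complex) \<Rightarrow> complex) \<Rightarrow> ('a \<Rightarrow> complex) set \<Rightarrow> ('a \<Rightarrow> complex) \<Rightarrow> complex"
  where "restrict_form f U = (\<lambda>v. if v \<in> U then f v else 0)"

definition Ker :: "('a \<Rightarrow> complex) set \<Rightarrow> (('a \<Rightarrow> complex) \<Rightarrow> complex) \<Rightarrow> ('a \<Rightarrow> complex) set"
  where "Ker W f = {v \<in> W. f v = 0}"


section \<open>The root system \<open>BC\<^sub>n\<close> and its root subsystems\<close>

text \<open>Coordinates are numbered \<open>0, \<dots>, n - 1\<close>.\<close>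

definition std_basis :: "nat \<Rightarrow> nat \<Rightarrow> complex"
  where "std_basis i = (\<lambda>j. if j = i then 1 else 0)"

definition dual_basis :: "nat \<Rightarrow> nat \<Rightarrow> (nat \<Rightarrow> complex) \<Rightarrow> complex"
  where "dual_basis n i = restrict_form (\<lambda>v. v i) (Cn n)"

definition BC :: "nat \<Rightarrow> ((nat \<Rightarrow> complex) \<Rightarrow> complex) set"
  where "BC n =
    {a *\<^sub>F dual_basis n i + b *\<^sub>F dual_basis n j | a b i j.
       a \<in> {1, -1} \<and> b \<in> {1, -1} \<and> i < n \<and> j < n \<and> i \<noteq> j} \<union>
    {a *\<^sub>F dual_basis n i | a i. a \<in> {1, -1, 2, -2} \<and> i < n}"

text \<open>
  The coordinates of a form \<open>f\<close> with respect to the dual basis are the values \<open>f (std_basis i)\<close>,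
  so this is the scalar product for which the dual basis is orthonormal.
\<close>

definition form_inner ::
    "nat \<Rightarrow> ((nat \<Rightarrow> complex) \<Rightarrow> complex) \<Rightarrow> ((nat \<Rightarrow> complex) \<Rightarrow> complex) \<Rightarrow> complex"
  where "form_inner n f g = (\<Sum>i<n. f (std_basis i) * cnj (g (std_basis i)))"

definition reflection ::
    "nat \<Rightarrow> ((nat \<Rightarrow> complex) \<Rightarrow> complex) \<Rightarrow> ((nat \<Rightarrow> complex) \<Rightarrow> complex) \<Rightarrow> (nat \<Rightarrow> complex) \<Rightarrow> complex"
  where "reflection n a f = f - (2 * form_inner n f a / form_inner n a a) *\<^sub>F a"

definition root_subsystem :: "nat \<Rightarrow> ((nat \<Rightarrow> complex) \<Rightarrow> complex) set \<Rightarrow> bool"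
  where "root_subsystem n \<Phi> \<longleftrightarrow> \<Phi> \<subseteq> BC n \<and> (\<forall>a\<in>\<Phi>. reflection n a ` \<Phi> \<subseteq> \<Phi>)"


section \<open>Hyperplane arrangements\<close>

text \<open>An arrangement is a pair of its ambient space and its set of hyperplanes.\<close>

type_synonym 'a arrangement = "('a \<Rightarrow> complex) set \<times> ('a \<Rightarrow> complex) set set"

definition hyperplane_arrangement :: "'a arrangement \<Rightarrow> bool"
  where "hyperplane_arrangement A \<longleftrightarrow>
    fun_vs.subspace (fst A) \<and> (\<exists>B. finite B \<and> fun_vs.span B = fst A) \<and> finite (snd A) \<and>
    (\<forall>H\<in>snd A. \<exists>f\<in>dual_space (fst A). f \<noteq> 0 \<and> H = Ker (fst A) f)"

definition linear_iso ::
    "('a \<Rightarrow> complex) set \<Rightarrow> ('b \<Rightarrow> complex) set \<Rightarrow> (('a \<Rightarrow> complex) \<Rightarrow> 'b \<Rightarrow> complex) \<Rightarrow> bool"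
  where "linear_iso U W f \<longleftrightarrow> bij_betw f U W \<and>
    (\<forall>u\<in>U. \<forall>v\<in>U. f (u + v) = f u + f v) \<and> (\<forall>c. \<forall>v\<in>U. f (c *\<^sub>F v) = c *\<^sub>F f v)"

definition isomorphic_arrangements :: "'a arrangement \<Rightarrow> 'b arrangement \<Rightarrow> bool"
  where "isomorphic_arrangements A B \<longleftrightarrow>
    (\<exists>f. linear_iso (fst A) (fst B) f \<and> (`) f ` snd A = snd B)"

text \<open>
  The direct sum of \<open>W\<^sub>0, \<dots>, W\<^sub>N\<^sub>-\<^sub>1\<close> consists of the doubly indexed families whose \<open>k\<close>-th row is
  in \<open>W\<^sub>k\<close> for \<open>k < N\<close> and is zero for \<open>k \<ge> N\<close>.
\<close>

definition sum_space :: "('a \<Rightarrow> complex) set list \<Rightarrow> (nat \<times> 'a \<Rightarrow> complex) set"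
  where "sum_space Ws =
    {v. (\<forall>k<length Ws. (\<lambda>i. v (k, i)) \<in> Ws ! k) \<and> (\<forall>k\<ge>length Ws. \<forall>i. v (k, i) = 0)}"

definition direct_sum :: "'a arrangement list \<Rightarrow> (nat \<times> 'a) arrangement"
  where "direct_sum As =
    (let W = sum_space (map fst As)
     in (W, {{v \<in> W. (\<lambda>i. v (k, i)) \<in> H} | k H. k < length As \<and> H \<in> snd (As ! k)}))"


section \<open>Arrangements of classical and exotic type\<close>

definition difference_planes :: "nat \<Rightarrow> (nat \<Rightarrow> complex) set set"
  where "difference_planes m = {{z \<in> Cn m. z i - z j = 0} | i j. i < m \<and> j < m \<and> i \<noteq> j}"

definition sum_planes :: "nat \<Rightarrow> (nat \<Rightarrow> complex) set set"
  where "sum_planes m = {{z \<in> Cn m. z i + z j = 0} | i j. i < m \<and> j < m \<and> i \<noteq> j}"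

text \<open>\<open>type_A m\<close> is the arrangement of type \<open>A\<^sub>m\<^sub>-\<^sub>1\<close>.\<close>

definition type_A :: "nat \<Rightarrow> nat arrangement"
  where "type_A m = (Cn m, difference_planes m)"

definition type_D :: "nat \<Rightarrow> nat arrangement"
  where "type_D m = (Cn m, difference_planes m \<union> sum_planes m)"

definition type_BC :: "nat \<Rightarrow> nat arrangement"
  where "type_BC m = (Cn m, difference_planes m \<union> sum_planes m \<union> {{z \<in> Cn m. z i = 0} | i. i < m})"

definition type_BCD :: "nat \<Rightarrow> nat \<Rightarrow> nat arrangement"
  where "type_BCD r s =
    (Cn (r + s), difference_planes (r + s) \<union> sum_planes (r + s) \<union> {{z \<in> Cn (r + s). z i = 0} | i. i < r})"

definition classical_type :: "nat arrangement \<Rightarrow> bool"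
  where "classical_type A \<longleftrightarrow> (\<exists>m\<ge>1. A = type_A m \<or> A = type_D m \<or> A = type_BC m)"

definition exotic_type :: "nat \<Rightarrow> nat arrangement \<Rightarrow> bool"
  where "exotic_type n A \<longleftrightarrow> (\<exists>r s. r + s \<le> n \<and> A = type_BCD r s)"


section \<open>The restricted arrangement\<close>

definition common_kernel ::
    "nat \<Rightarrow> ((nat \<Rightarrow> complex) \<Rightarrow> complex) set \<Rightarrow> (nat \<Rightarrow> complex) set"
  where "common_kernel n \<Phi> = Cn n \<inter> (\<Inter>a\<in>\<Phi>. Ker (Cn n) a)"

definition restricted_arrangement ::
    "nat \<Rightarrow> ((nat \<Rightarrow> complex) \<Rightarrow> complex) set \<Rightarrow> ((nat \<Rightarrow> complex) \<Rightarrow> complex) set \<Rightarrow> nat arrangement"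
  where "restricted_arrangement n \<Phi> \<Phi>' =
    (let U = common_kernel n \<Phi>'
     in (U, {Ker U (restrict_form a U) | a. a \<in> \<Phi> - \<Phi>' \<and> restrict_form a U \<noteq> 0}))"

end

theory Submission
  imports Defs
begin

text \<open>
  Write \<open>\<alpha>\<^sub>i\<close> for the coordinate forms. Up to a scalar, a root is either \<open>\<alpha>\<^sub>i - e \<alpha>\<^sub>j\<close>
  with \<open>i \<noteq> j\<close> and a sign \<open>e\<close>, or \<open>\<alpha>\<^sub>i\<close>. So a root subsystem is a signed graph on the
  coordinates: an edge from \<open>i\<close> to \<open>j\<close> with sign \<open>e\<close> for the former, a loop for the latter.
  Reflections compose edges and multiply their signs, and they turn an edge that starts at a loop
  into the edge of opposite sign. Hence the graph is almost an equivalence relation with signs,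
  \<open>S i j e\<close>, to be read as ``the equation \<open>v\<^sub>i = e v\<^sub>j\<close>''. The exception is that
  \<open>\<alpha>\<^sub>i - \<alpha>\<^sub>j\<close> and \<open>\<alpha>\<^sub>i + \<alpha>\<^sub>j\<close> do not force \<open>\<alpha>\<^sub>i\<close> to be a root, although together they
  imply \<open>v\<^sub>i = -v\<^sub>i\<close>. Adding \<open>S i i (-1)\<close> in this case as well (\<open>tied\<close>) makes transitivity
  hold without exception (\<open>signed_equivalence_tied\<close>). A class that contains such an \<open>i\<close> is
  unbalanced, and then any two of its members are related with both signs. In a balanced class the
  sign between two members is unique, and it is a coboundary: \<open>e = sg i * sg j\<close>
  (\<open>sign_eq\<close>). Balanced classes are the components of type \<open>A\<close>, unbalanced ones those of type
  \<open>B\<close>, \<open>C\<close>, \<open>BC\<close> or \<open>D\<close>.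

  Let \<open>T\<close> and \<open>S\<close> be the relations of \<open>\<Phi>'\<close> and \<open>\<Phi>\<close>. The space \<open>U\<close> is cut out by the
  equations of \<open>T\<close> (\<open>common_kernel_eq_invariants\<close>): its vectors vanish on unbalanced classes of
  \<open>T\<close> and are determined by their value at one representative of each balanced class. In the
  coordinates of the representatives a root of \<open>\<Phi>\<close> gives either an equation \<open>v\<^sub>p = d v\<^sub>q\<close> with
  \<open>p \<noteq> q\<close> and \<open>S p q d\<close>, or \<open>v\<^sub>p = 0\<close>, and the latter happens only if \<open>p\<close> is unbalanced in
  \<open>S\<close> (\<open>plane_cases\<close>). All equations of the first kind do occur.

  Therefore the arrangement splits along the classes of \<open>S\<close> on the representatives. In a balanced
  class the coordinates \<open>sg p * v\<^sub>p\<close> remove the signs and leave exactly the planes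
  \<open>z\<^sub>a = z\<^sub>b\<close>, which is type \<open>A\<close>. In an unbalanced class all planes \<open>z\<^sub>a = \<plusminus>z\<^sub>b\<close> occur
  together with \<open>z\<^sub>a = 0\<close> for an arbitrary set of indices \<open>a\<close>; listing these indices first gives
  type \<open>(B\<^sub>r/C\<^sub>r)D\<^sub>r\<^sub>+\<^sub>s\<close>. That set can be a proper nonempty subset because a hyperplane
  \<open>v\<^sub>p = 0\<close> may arise from two members of the \<open>T\<close>-class of \<open>p\<close> that \<open>\<Phi>\<close> relates with
  both signs; this explains the exotic arrangements.
\<close>

section \<open>Signed equivalence relations\<close>

text \<open>
  Equivalently, an equivalence relation on the \<open>2 n\<close> signed coordinates \<open>\<plusminus>\<alpha>\<^sub>i\<close> that is
  invariant under negation; \<open>S i j e\<close> says that \<open>\<alpha>\<^sub>i\<close> is equivalent to \<open>e \<alpha>\<^sub>j\<close>.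
\<close>

locale signed_equivalence =
  fixes n :: nat and S :: "nat \<Rightarrow> nat \<Rightarrow> complex \<Rightarrow> bool"
  assumes dom: "S i j e \<Longrightarrow> i < n \<and> j < n \<and> (e = 1 \<or> e = -1)"
    and refl: "i < n \<Longrightarrow> S i i 1"
    and sym: "S i j e \<Longrightarrow> S j i e"
    and trans: "S i j e \<Longrightarrow> S j k d \<Longrightarrow> S i k (e * d)"
begin

definition balanced :: "nat \<Rightarrow> bool"
  where "balanced i \<longleftrightarrow> i < n \<and> \<not> S i i (-1)"

definition rep :: "nat \<Rightarrow> nat"
  where "rep i = (LEAST j. \<exists>e. S i j e)"

text \<open>
  In an unbalanced class both signs are possible and an arbitrary one is chosen. Outside the range
  of the coordinates the value is \<open>1\<close>, so that \<open>sg\<close> is a sign everywhere.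
\<close>

definition sg :: "nat \<Rightarrow> complex"
  where "sg i = (if i < n then SOME e. S i (rep i) e else 1)"

definition reps :: "nat set"
  where "reps = {i. balanced i \<and> rep i = i}"

definition invariants :: "(nat \<Rightarrow> complex) set"
  where "invariants = {v \<in> Cn n. \<forall>i j e. S i j e \<longrightarrow> v i = e * v j}"

definition extend :: "(nat \<Rightarrow> complex) \<Rightarrow> nat \<Rightarrow> complex"
  where "extend w = (\<lambda>i. if balanced i then sg i * w (rep i) else 0)"

lemma S_rep: assumes "i < n" shows "S i (rep i) (sg i)"
proof -
  have "\<exists>e. S i (rep i) e"
    unfolding rep_def by (rule LeastI[of _ i]) (use refl[OF assms] in blast)
  then show ?thesis unfolding sg_def using assms by (simp add: someI_ex)
qed

lemma sg_cases: "sg i = 1 \<or> sg i = -1"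
  using S_rep[of i] dom[of i "rep i" "sg i"] by (cases "i < n") (auto simp: sg_def)

lemma sg_square [simp]: "sg i * sg i = 1" "sg i * (sg i * x) = x"
  using sg_cases[of i] by auto

lemma sg_nonzero [simp]: "sg i \<noteq> 0"
  using sg_cases[of i] by auto

lemma rep_eq: assumes "S i j e" shows "rep i = rep j"
proof -
  have "(\<exists>d. S i k d) \<longleftrightarrow> (\<exists>d. S j k d)" for k
    using assms sym trans by blast
  then show ?thesis by (simp add: rep_def)
qed

lemma unbalanced_cong: assumes "S i j e" "S i i (-1)" shows "S j j (-1)"
proof -
  have "S j j (e * (-1 * e))" using assms sym trans by blast
  then show ?thesis using dom[OF assms(1)] by auto
qed

lemma balanced_cong: "S i j e \<Longrightarrow> balanced i \<longleftrightarrow> balanced j"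
  using unbalanced_cong sym dom by (metis balanced_def)

text \<open>
  Going from \<open>i\<close> to \<open>j\<close>, on to the common representative and back to \<open>i\<close> relates \<open>i\<close> to
  itself with the product of the three signs, and a balanced \<open>i\<close> only allows the product \<open>1\<close>.
\<close>

lemma sign_eq: assumes "S i j e" "balanced i" shows "e = sg i * sg j"
proof -
  have n: "i < n" "j < n" using dom[OF assms(1)] by auto
  have "S i i (e * sg j * sg i)"
    using trans[OF trans[OF assms(1) S_rep[OF n(2)]] sym] S_rep[OF n(1)] rep_eq[OF assms(1)]
    by auto
  then have "e * sg j * sg i \<noteq> -1" using assms(2) by (auto simp: balanced_def)
  then show ?thesis using dom[OF assms(1)] sg_cases[of i] sg_cases[of j] by auto
qed

lemma same_class: assumes "i < n" "j < n" "rep i = rep j" shows "S i j (sg i * sg j)"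
  using trans[OF S_rep[OF assms(1)] sym] S_rep[OF assms(2)] assms(3) by auto

lemma sg_reps: "i \<in> reps \<Longrightarrow> sg i = 1"
  using S_rep[of i] sg_cases[of i] by (auto simp: reps_def balanced_def)

lemma rep_in_reps: assumes "balanced i" shows "rep i \<in> reps"
proof -
  have "S i (rep i) (sg i)" using assms S_rep by (auto simp: balanced_def)
  from balanced_cong[OF this] rep_eq[OF this] assms have "balanced (rep i)" "rep (rep i) = rep i"
    by simp_all
  then show ?thesis by (simp add: reps_def)
qed

lemma reps_less: "i \<in> reps \<Longrightarrow> i < n"
  by (simp add: reps_def balanced_def)

lemma finite_reps: "finite reps"
  using reps_less by (meson finite_nat_set_iff_bounded)

lemma invariants_rep: "v \<in> invariants \<Longrightarrow> i < n \<Longrightarrow> v i = sg i * v (rep i)"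
  using S_rep by (auto simp: invariants_def)

lemma invariants_unbalanced:
  assumes "v \<in> invariants" "\<not> balanced i" shows "v i = 0"
proof (cases "i < n")
  case True
  then have "S i i (-1)" using assms by (auto simp: balanced_def)
  then have "v i = -1 * v i" using assms(1) unfolding invariants_def by blast
  then show ?thesis by simp
next
  case False
  then show ?thesis using assms by (auto simp: invariants_def Cn_def)
qed

text \<open>
  Together with \<open>extend_reps\<close> and \<open>invariants_eqI\<close> this shows that the values at the
  representatives are free coordinates on the invariant vectors.
\<close>

lemma extend_invariants: "extend w \<in> invariants"
proof -
  have "extend w i = e * extend w j" if "S i j e" for i j e
  proof (cases "balanced i")
    case True
    then have "e = sg i * sg j" "balanced j" "rep i = rep j"
      using that sign_eq balanced_cong rep_eq by auto
    then show ?thesis using True by (simp add: extend_def)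
  next
    case False
    then show ?thesis using balanced_cong[OF that] by (simp add: extend_def)
  qed
  then show ?thesis by (auto simp: invariants_def Cn_def extend_def balanced_def)
qed

lemma extend_reps: "i \<in> reps \<Longrightarrow> extend w i = w i"
  using sg_reps[of i] by (auto simp: extend_def reps_def)

lemma invariants_eqI:
  assumes "v \<in> invariants" "w \<in> invariants" "\<And>i. i \<in> reps \<Longrightarrow> v i = w i"
  shows "v = w"
proof
  fix i
  show "v i = w i"
  proof (cases "balanced i")
    case True
    then have "i < n" "rep i \<in> reps" using rep_in_reps by (auto simp: balanced_def)
    then show ?thesis
      using invariants_rep[OF assms(1), of i] invariants_rep[OF assms(2), of i] assms(3)[of "rep i"]
      by simp
  next
    case False
    then show ?thesis
      by (simp add: invariants_unbalanced[OF assms(1)] invariants_unbalanced[OF assms(2)])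
  qed
qed

lemma subspace_invariants: "fun_vs.subspace invariants"
proof (rule fun_vs.subspaceI)
  have tie: "v i = e * v j" if "v \<in> invariants" "S i j e" for v i j e
    using that unfolding invariants_def by blast
  have Cn: "v i = 0" if "v \<in> invariants" "i \<ge> n" for v i
    using that by (simp add: invariants_def Cn_def)
  show "0 \<in> invariants" by (simp add: invariants_def Cn_def)
  show "u + v \<in> invariants" if uv: "u \<in> invariants" "v \<in> invariants" for u v
  proof -
    have "u i + v i = e * (u j + v j)" if "S i j e" for i j e
      using tie[OF uv(1) that] tie[OF uv(2) that] by (simp add: distrib_left)
    then show ?thesis using Cn[OF uv(1)] Cn[OF uv(2)] by (simp add: invariants_def Cn_def)
  qed
  show "c *\<^sub>F v \<in> invariants" if v: "v \<in> invariants" for c v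
  proof -
    have "c * v i = e * (c * v j)" if "S i j e" for i j e
      using tie[OF v that] by simp
    then show ?thesis using Cn[OF v] by (simp add: invariants_def Cn_def scale_fun_def)
  qed
qed

end

definition plane :: "(nat \<Rightarrow> complex) set \<Rightarrow> nat \<Rightarrow> nat \<Rightarrow> complex \<Rightarrow> (nat \<Rightarrow> complex) set"
  where "plane U i j e = {v \<in> U. v i = e * v j}"

section \<open>Coordinates adapted to the components\<close>

text \<open>
  The fibres of \<open>c\<close> on \<open>I\<close> become the summands of the arrangement. In each of them the elements
  of \<open>L\<close> come first because \<open>type_BCD r s\<close> has the planes \<open>z\<^sub>i = 0\<close> exactly for \<open>i < r\<close>.
\<close>

lemma component_lists:
  fixes c :: "nat \<Rightarrow> nat"
  assumes "finite I"
  obtains xss :: "nat list list" and r :: "nat \<Rightarrow> nat" where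
    "set (concat xss) = I"
    "\<And>xs. xs \<in> set xss \<Longrightarrow> xs \<noteq> [] \<and> distinct xs"
    "\<And>k l x y. k < length xss \<Longrightarrow> l < length xss \<Longrightarrow> x \<in> set (xss ! k) \<Longrightarrow> y \<in> set (xss ! l)
       \<Longrightarrow> c x = c y \<longleftrightarrow> k = l"
    "\<And>k. k < length xss \<Longrightarrow> r k \<le> length (xss ! k)"
    "\<And>k a. k < length xss \<Longrightarrow> a < length (xss ! k) \<Longrightarrow> xss ! k ! a \<in> L \<longleftrightarrow> a < r k"
proof -
  define cs where "cs = sorted_list_of_set (c ` I)"
  define yes where "yes d = sorted_list_of_set {i \<in> I. c i = d \<and> i \<in> L}" for d
  define no where "no d = sorted_list_of_set {i \<in> I. c i = d \<and> i \<notin> L}" for d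
  define xss where "xss = map (\<lambda>d. yes d @ no d) cs"
  define r where "r k = length (yes (cs ! k))" for k
  have cs: "set cs = c ` I" "distinct cs" using assms by (auto simp: cs_def)
  have y: "set (yes d) = {i \<in> I. c i = d \<and> i \<in> L}" "distinct (yes d)" for d
    using assms by (auto simp: yes_def)
  have nn: "set (no d) = {i \<in> I. c i = d \<and> i \<notin> L}" "distinct (no d)" for d
    using assms by (auto simp: no_def)
  have k: "c x = cs ! k" if "k < length xss" "x \<in> set (xss ! k)" for k x
    using that y nn by (auto simp: xss_def)
  show ?thesis
  proof
    show "set (concat xss) = I" using cs y nn by (auto simp: xss_def)
    show "xs \<noteq> [] \<and> distinct xs" if "xs \<in> set xss" for xs
    proof -
      have "xs \<in> (\<lambda>d. yes d @ no d) ` c ` I" using that cs(1) by (simp add: xss_def)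
      then obtain d where d: "xs = yes d @ no d" "d \<in> c ` I" by blast
      have "set xs = {i \<in> I. c i = d}" unfolding d(1) using y nn by auto
      then have "xs \<noteq> []" using d(2) by auto
      then show ?thesis using d(1) y nn by auto
    qed
    show "c x = c y \<longleftrightarrow> k = l"
      if "k < length xss" "l < length xss" "x \<in> set (xss ! k)" "y \<in> set (xss ! l)" for k l x y
      using k[OF that(1,3)] k[OF that(2,4)] cs that by (auto simp: nth_eq_iff_index_eq xss_def)
    show "r k \<le> length (xss ! k)" if "k < length xss" for k
      using that by (auto simp: r_def xss_def)
    show "xss ! k ! a \<in> L \<longleftrightarrow> a < r k" if "k < length xss" "a < length (xss ! k)" for k a
    proof (cases "a < r k")
      case True
      then have "xss ! k ! a \<in> set (yes (cs ! k))"
        using that by (auto simp: r_def xss_def nth_append)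
      then show ?thesis using True y by auto
    next
      case False
      then have "xss ! k ! a \<in> set (no (cs ! k))"
        using that by (auto simp: r_def xss_def nth_append)
      then show ?thesis using False nn by auto
    qed
  qed
qed

definition coordinates ::
    "nat list list \<Rightarrow> (nat \<Rightarrow> complex) \<Rightarrow> (nat \<Rightarrow> complex) \<Rightarrow> nat \<times> nat \<Rightarrow> complex"
  where "coordinates xss t v = (\<lambda>(k, a).
    if k < length xss \<and> a < length (xss ! k) then t (xss ! k ! a) * v (xss ! k ! a) else 0)"

lemma in_concat_nth:
  assumes "x \<in> set (concat xss)"
  obtains k a where "k < length xss" "a < length (xss ! k)" "xss ! k ! a = x"
  using assms by (auto simp: in_set_conv_nth)

lemma nth_in_concat: "k < length xss \<Longrightarrow> a < length (xss ! k) \<Longrightarrow> xss ! k ! a \<in> set (concat xss)"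
  using nth_mem by (metis UN_I set_concat)

text \<open>
  The lists enumerate the representatives without repetition, so these are the free coordinates
  on the invariants, scaled by signs and arranged in rows.
\<close>

lemma (in signed_equivalence) linear_iso_coordinates:
  assumes reps: "set (concat xss) = reps"
    and inj: "\<And>k l a b. k < length xss \<Longrightarrow> l < length xss \<Longrightarrow> a < length (xss ! k) \<Longrightarrow>
      b < length (xss ! l) \<Longrightarrow> xss ! k ! a = xss ! l ! b \<Longrightarrow> k = l \<and> a = b"
    and t: "\<And>i. t i * t i = 1"
  shows "linear_iso invariants (sum_space (map (\<lambda>xs. Cn (length xs)) xss)) (coordinates xss t)"
proof -
  have t0: "t i \<noteq> 0" for i using t[of i] by auto
  have into: "coordinates xss t v \<in> sum_space (map (\<lambda>xs. Cn (length xs)) xss)" for v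
    by (auto simp: sum_space_def Cn_def coordinates_def)
  have inj_c: "inj_on (coordinates xss t) invariants"
  proof (rule inj_onI, rule invariants_eqI)
    fix v w i assume eq: "coordinates xss t v = coordinates xss t w" and "i \<in> reps"
    then obtain k a where "k < length xss" "a < length (xss ! k)" "xss ! k ! a = i"
      using in_concat_nth reps by metis
    then show "v i = w i" using fun_cong[OF eq, of "(k, a)"] t0 by (simp add: coordinates_def)
  qed auto
  have surj: "\<exists>v\<in>invariants. coordinates xss t v = z"
    if z: "z \<in> sum_space (map (\<lambda>xs. Cn (length xs)) xss)" for z
  proof -
    \<comment> \<open>The inverse: read off the value at each representative from its position in the lists,
        undo the sign, and extend.\<close>
    define pos where "pos i = (SOME p. fst p < length xss \<and> snd p < length (xss ! fst p) \<and>
      xss ! fst p ! snd p = i)" for i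
    define v where "v = extend (\<lambda>i. t i * z (pos i))"
    have pos: "pos (xss ! k ! a) = (k, a)" if "k < length xss" "a < length (xss ! k)" for k a
      unfolding pos_def
    proof (rule some_equality)
      fix p assume "fst p < length xss \<and> snd p < length (xss ! fst p) \<and>
        xss ! fst p ! snd p = xss ! k ! a"
      then show "p = (k, a)" using inj[of "fst p" k "snd p" a] that by (auto simp: prod_eq_iff)
    qed (use that in auto)
    have "coordinates xss t v (k, a) = z (k, a)" for k a
    proof (cases "k < length xss \<and> a < length (xss ! k)")
      case True
      then have "xss ! k ! a \<in> reps" using nth_in_concat reps by blast
      then show ?thesis using True pos t by (simp add: coordinates_def v_def extend_reps flip: mult.assoc)
    next
      case False
      then show ?thesis using z by (cases "k < length xss") (auto simp: coordinates_def sum_space_def Cn_def)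
    qed
    then show ?thesis using extend_invariants unfolding v_def by fastforce
  qed
  have bij: "bij_betw (coordinates xss t) invariants (sum_space (map (\<lambda>xs. Cn (length xs)) xss))"
    unfolding bij_betw_def using inj_c into surj by blast
  show ?thesis unfolding linear_iso_def
    by (intro conjI bij)
      (auto simp: coordinates_def scale_fun_def fun_eq_iff distrib_left)
qed

section \<open>The restricted arrangement of a nested pair\<close>

locale nested_signed_equivalences =
  S: signed_equivalence n S + T: signed_equivalence n T for n S T +
  assumes nested: "T i j e \<Longrightarrow> S i j e"
begin

lemma unbalanced_rep: assumes "i < n" "S i i (-1)" shows "S (T.rep i) (T.rep i) (-1)"
  using S.unbalanced_cong[OF nested[OF T.S_rep[OF assms(1)]] assms(2)] .

text \<open>
  Replace \<open>v\<^sub>i\<close> and \<open>v\<^sub>j\<close> by their expressions in terms of representatives. The equation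
  \<open>v\<^sub>i = e v\<^sub>j\<close> degenerates to \<open>v\<^sub>p = 0\<close> in two ways: one of \<open>i\<close> and \<open>j\<close> is
  unbalanced for \<open>T\<close>, or both have the same representative and \<open>e\<close> is the sign with which
  \<open>T\<close> does not relate them. In both cases \<open>p\<close> becomes unbalanced for the larger relation
  \<open>S\<close>.
\<close>

lemma plane_cases:
  assumes "S i j e" "plane T.invariants i j e \<noteq> T.invariants"
  obtains p q d where "p \<in> T.reps" "q \<in> T.reps" "p \<noteq> q" "S p q d"
      "plane T.invariants i j e = plane T.invariants p q d"
  | p where "p \<in> T.reps" "S p p (-1)" "plane T.invariants i j e = {v \<in> T.invariants. v p = 0}"
proof -
  have n: "i < n" "j < n" and e: "e = 1 \<or> e = -1" using S.dom[OF assms(1)] by auto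
  have e0: "e \<noteq> 0" using e by auto
  note val = T.invariants_rep[OF _ n(1)] T.invariants_rep[OF _ n(2)]
  have unb: "S k k (-1)" if "k < n" "\<not> T.balanced k" for k
    using that nested by (auto simp: T.balanced_def)
  consider "T.balanced i" "T.balanced j" "T.rep i \<noteq> T.rep j"
    | "T.balanced i" "T.balanced j" "T.rep i = T.rep j"
    | "T.balanced i" "\<not> T.balanced j" | "\<not> T.balanced i" "T.balanced j"
    | "\<not> T.balanced i" "\<not> T.balanced j" by blast
  then show ?thesis
  proof cases
    case 1
    define d where "d = T.sg i * e * T.sg j"
    have S: "S (T.rep i) (T.rep j) d" unfolding d_def
      using S.trans S.sym nested T.S_rep n assms(1) by meson
    have "v i = e * v j \<longleftrightarrow> v (T.rep i) = d * v (T.rep j)" if "v \<in> T.invariants" for v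
    proof -
      have "T.sg i * a = b \<longleftrightarrow> a = T.sg i * b" for a b by (metis T.sg_square(2))
      then show ?thesis using val[OF that] by (simp add: d_def mult.assoc)
    qed
    then have "plane T.invariants i j e = plane T.invariants (T.rep i) (T.rep j) d"
      by (auto simp: plane_def)
    then show ?thesis using that(1) 1 S T.rep_in_reps by blast
  next
    case 2
    have ne: "T.sg i \<noteq> e * T.sg j"
    proof
      assume "T.sg i = e * T.sg j"
      then have "v i = e * v j" if "v \<in> T.invariants" for v
        using val[OF that] 2 by simp
      then show False using assms(2) by (auto simp: plane_def)
    qed
    have "S (T.rep i) (T.rep j) (T.sg i * e * T.sg j)"
      using S.trans S.sym nested T.S_rep n assms(1) by meson
    moreover have "T.sg i * e * T.sg j = -1"
      using ne e T.sg_cases[of i] T.sg_cases[of j] by auto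
    moreover have "v i = e * v j \<longleftrightarrow> v (T.rep i) = 0" if "v \<in> T.invariants" for v
      using val[OF that] ne 2(3) by (auto simp flip: mult.assoc)
    ultimately show ?thesis using that(2)[of "T.rep i"] T.rep_in_reps 2 by (auto simp: plane_def)
  next
    case 3
    have "S i i (-1)" using unb[OF n(2) 3(2)] S.unbalanced_cong S.sym assms(1) by blast
    moreover have "v i = e * v j \<longleftrightarrow> v (T.rep i) = 0" if "v \<in> T.invariants" for v
      using val(1)[OF that] T.invariants_unbalanced[OF that 3(2)] by simp
    ultimately show ?thesis
      using that(2)[of "T.rep i"] T.rep_in_reps 3 unbalanced_rep n by (auto simp: plane_def)
  next
    case 4
    have "S j j (-1)" using unb[OF n(1) 4(1)] S.unbalanced_cong assms(1) by blast
    moreover have "v i = e * v j \<longleftrightarrow> v (T.rep j) = 0" if "v \<in> T.invariants" for v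
      using val(2)[OF that] T.invariants_unbalanced[OF that 4(1)] e0 by simp
    ultimately show ?thesis
      using that(2)[of "T.rep j"] T.rep_in_reps 4 unbalanced_rep n by (auto simp: plane_def)
  next
    case 5
    then have "v i = e * v j" if "v \<in> T.invariants" for v
      using T.invariants_unbalanced[OF that] by simp
    then have False using assms(2) by (auto simp: plane_def)
    then show ?thesis ..
  qed
qed

lemma plane_reps_proper:
  assumes "p \<in> T.reps" "q \<in> T.reps" "p \<noteq> q"
  shows "plane T.invariants p q d \<noteq> T.invariants"
proof -
  define w :: "nat \<Rightarrow> complex" where "w = T.extend (\<lambda>i. if i = p then 1 else 0)"
  have "w \<in> T.invariants" "w p = 1" "w q = 0"
    using assms T.extend_invariants T.extend_reps by (auto simp: w_def)
  then have "w \<in> T.invariants" "w \<notin> plane T.invariants p q d" by (simp_all add: plane_def)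
  then show ?thesis by metis
qed

text \<open>
  The assumptions leave open which of the planes \<open>v\<^sub>p = 0\<close> with \<open>S p p (-1)\<close> belong to the
  arrangement. This is all the freedom that there is, and it is absorbed by the parameter \<open>r\<close> of
  \<open>type_BCD\<close>.
\<close>

lemma arrangement_isomorphic_direct_sum:
  assumes sub: "\<And>H. H \<in> \<H> \<Longrightarrow> \<exists>i j e. S i j e \<and> H = plane T.invariants i j e \<and> H \<noteq> T.invariants"
    and sup: "\<And>i j e. S i j e \<Longrightarrow> i \<noteq> j \<Longrightarrow> plane T.invariants i j e \<noteq> T.invariants \<Longrightarrow>
      plane T.invariants i j e \<in> \<H>"
  shows "\<exists>As. (\<forall>A\<in>set As. classical_type A \<or> exotic_type n A) \<and>
    isomorphic_arrangements (T.invariants, \<H>) (direct_sum As)"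
proof -
  let ?U = "T.invariants"
  define L where "L = {i \<in> T.reps. S i i (-1) \<and> {v \<in> ?U. v i = 0} \<in> \<H>}"
  have H_eq: "\<H> = {plane ?U i j e | i j e. i \<in> T.reps \<and> j \<in> T.reps \<and> i \<noteq> j \<and> S i j e} \<union>
    {{v \<in> ?U. v i = 0} | i. i \<in> L}" (is "_ = ?R")
  proof
    show "\<H> \<subseteq> ?R"
    proof
      fix H assume H: "H \<in> \<H>"
      then obtain i j e where ije: "S i j e" "H = plane ?U i j e" "H \<noteq> ?U" using sub by blast
      then have "plane ?U i j e \<noteq> ?U" by simp
      with ije(1) show "H \<in> ?R"
        using ije(2) H by (cases rule: plane_cases) (auto simp: L_def)
    qed
    show "?R \<subseteq> \<H>" using sup plane_reps_proper by (auto simp: L_def)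
  qed
  obtain xss r where xss: "set (concat xss) = T.reps"
    "\<And>xs. xs \<in> set xss \<Longrightarrow> xs \<noteq> [] \<and> distinct xs"
    "\<And>k l x y. k < length xss \<Longrightarrow> l < length xss \<Longrightarrow> x \<in> set (xss ! k) \<Longrightarrow> y \<in> set (xss ! l)
       \<Longrightarrow> S.rep x = S.rep y \<longleftrightarrow> k = l"
    "\<And>k. k < length xss \<Longrightarrow> r k \<le> length (xss ! k)"
    "\<And>k a. k < length xss \<Longrightarrow> a < length (xss ! k) \<Longrightarrow> xss ! k ! a \<in> L \<longleftrightarrow> a < r k"
    by (rule component_lists[OF T.finite_reps, where c = S.rep and L = L]; rule that; blast)
  define N where "N = length xss"
  define m where "m k = length (xss ! k)" for k
  define x where "x k a = xss ! k ! a" for k a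
  define W where "W = sum_space (map (\<lambda>xs. Cn (length xs)) xss)"
  define f where "f = coordinates xss S.sg"
  \<comment> \<open>All rows are nonempty, and balancedness is constant along a row.\<close>
  define unb where "unb k \<longleftrightarrow> S (x k 0) (x k 0) (-1)" for k
  have x_reps: "x k a \<in> T.reps" if "k < N" "a < m k" for k a
    using nth_in_concat[of k xss a] that unfolding xss(1) N_def m_def x_def by blast
  have x_n: "x k a < n" if "k < N" "a < m k" for k a
    using T.reps_less x_reps that by blast
  have x_set: "x k a \<in> set (xss ! k)" if "a < m k" for k a
    using that by (simp add: m_def x_def)
  have x_ex: "\<exists>k<N. \<exists>a<m k. i = x k a" if "i \<in> T.reps" for i
    using that xss(1) in_concat_nth[of i xss] unfolding N_def m_def x_def by metis
  have m_pos: "m k > 0" if "k < N" for k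
    using that xss(2) by (auto simp: N_def m_def)
  have x_rep: "S.rep (x k a) = S.rep (x l b) \<longleftrightarrow> k = l" if "k < N" "l < N" "a < m k" "b < m l" for k l a b
    using xss(3)[of k l] x_set that by (auto simp: N_def)
  have x_inj: "x k a = x k b \<longleftrightarrow> a = b" if "k < N" "a < m k" "b < m k" for k a b
    using that xss(2)[of "xss ! k"] by (auto simp: N_def m_def x_def nth_eq_iff_index_eq)
  have x_S: "S (x k a) (x k b) (S.sg (x k a) * S.sg (x k b))" if "k < N" "a < m k" "b < m k" for k a b
    using that S.same_class x_n x_rep by simp
  have unb: "S (x k a) (x k a) (-1) \<longleftrightarrow> unb k" if "k < N" "a < m k" for k a
    using S.unbalanced_cong[OF x_S[of k a 0]] S.unbalanced_cong[OF x_S[of k 0 a]] that m_pos[of k]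
    unfolding unb_def by metis
  have S_unb: "S (x k a) (x k b) e" if "k < N" "a < m k" "b < m k" "unb k" "e = 1 \<or> e = -1" for k a b e
  proof -
    \<comment> \<open>A loop of sign \<open>-1\<close> at the end point produces the sign that is missing.\<close>
    let ?s = "S.sg (x k a) * S.sg (x k b)"
    have s: "S (x k a) (x k b) ?s" using x_S[OF that(1-3)] .
    have "S (x k a) (x k b) (?s * -1)" using S.trans[OF s] unb[OF that(1,3)] that(4) by blast
    moreover have "e = ?s \<or> e = ?s * -1"
      using that(5) S.sg_cases[of "x k a"] S.sg_cases[of "x k b"] by auto
    ultimately show ?thesis using s by metis
  qed
  have iso: "linear_iso ?U W f" unfolding W_def f_def
    using xss(1)
  proof (rule T.linear_iso_coordinates)
    fix k l a b
    assume h: "k < length xss" "l < length xss" "a < length (xss ! k)" "b < length (xss ! l)"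
      "xss ! k ! a = xss ! l ! b"
    then show "k = l \<and> a = b" using x_rep[of k l a b] x_inj[of k a b]
      by (auto simp: N_def m_def x_def)
  qed simp
  have f_im: "f ` {v \<in> ?U. P v} = {w \<in> W. Q w}" if "\<And>v. v \<in> ?U \<Longrightarrow> P v \<longleftrightarrow> Q (f v)" for P Q
    using iso that unfolding linear_iso_def bij_betw_def by blast
  have f_x: "f v (k, a) = S.sg (x k a) * v (x k a)" if "k < N" "a < m k" for v k a
    using that by (simp add: f_def coordinates_def N_def m_def x_def)
  have im1: "f ` plane ?U (x k a) (x k b) e =
      {w \<in> W. w (k, a) = S.sg (x k a) * e * S.sg (x k b) * w (k, b)}"
    if "k < N" "a < m k" "b < m k" for k a b e
    unfolding plane_def by (rule f_im) (simp add: f_x that mult.assoc)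
  have im0: "f ` {v \<in> ?U. v (x k a) = 0} = {w \<in> W. w (k, a) = 0}" if "k < N" "a < m k" for k a
    by (rule f_im) (simp add: f_x that)
  \<comment> \<open>Type \<open>D\<close> is \<open>type_BCD 0 m\<close> and type \<open>BC\<close> is \<open>type_BCD m 0\<close>, so two kinds of
      summands suffice.\<close>
  define As where "As = map (\<lambda>k. if unb k then type_BCD (r k) (m k - r k) else type_A (m k)) [0..<N]"
  have len: "length As = N" by (simp add: As_def)
  have As_k: "As ! k = (if unb k then type_BCD (r k) (m k - r k) else type_A (m k))" if "k < N" for k
    using that by (simp add: As_def)
  have rm: "r k \<le> m k" if "k < N" for k using that xss(4) by (simp add: N_def m_def)
  have "map fst As = map (\<lambda>xs. Cn (length xs)) xss"
  proof (rule nth_equalityI)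
    fix k assume "k < length (map fst As)"
    then have k: "k < N" by (simp add: len)
    then have "fst (As ! k) = Cn (m k)" using rm by (simp add: As_k type_BCD_def type_A_def)
    then show "map fst As ! k = map (\<lambda>xs. Cn (length xs)) xss ! k"
      using k by (simp add: len N_def m_def)
  qed (simp add: len N_def)
  then have W: "sum_space (map fst As) = W" by (simp add: W_def)
  have row: "(\<lambda>i. w (k, i)) \<in> Cn (m k)" if "w \<in> W" "k < N" for w k
    using that by (auto simp: W_def sum_space_def N_def m_def)
  have x_L: "x k a \<in> L \<longleftrightarrow> a < r k" if "k < N" "a < m k" for k a
    using that xss(5) by (simp add: N_def m_def x_def)
  have no_L: "x k a \<notin> L" if "k < N" "a < m k" "\<not> unb k" for k a
    using unb that by (auto simp: L_def)
  \<comment> \<open>The planes in the sum space, relating two coordinates of a row and annihilating one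
      coordinate. The next steps identify them as the images under \<open>f\<close> of the two kinds of
      planes in \<open>H_eq\<close>, and afterwards as the planes of the direct sum.\<close>
  define P1 where "P1 = {{w \<in> W. w (k, a) = d * w (k, b)} | k a b d.
    k < N \<and> a < m k \<and> b < m k \<and> a \<noteq> b \<and> (d = 1 \<or> d = -1 \<and> unb k)}"
  define P0 where "P0 = {{w \<in> W. w (k, a) = 0} | k a. k < N \<and> a < m k \<and> x k a \<in> L}"
  have "(`) f ` {plane ?U i j e | i j e. i \<in> T.reps \<and> j \<in> T.reps \<and> i \<noteq> j \<and> S i j e} = P1"
  proof (intro equalityI subsetI)
    fix H assume "H \<in> (`) f ` {plane ?U i j e | i j e. i \<in> T.reps \<and> j \<in> T.reps \<and> i \<noteq> j \<and> S i j e}"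
    then obtain i j e where ije: "i \<in> T.reps" "j \<in> T.reps" "i \<noteq> j" "S i j e"
      and H: "H = f ` plane ?U i j e" by blast
    obtain k a l b where ka: "k < N" "a < m k" "i = x k a" and lb: "l < N" "b < m l" "j = x l b"
      using x_ex ije by metis
    have kl: "l = k" using x_rep[of k l a b] S.rep_eq[OF ije(4)] ka lb by auto
    define d where "d = S.sg i * e * S.sg j"
    have "d = 1 \<or> d = -1"
      using S.sg_cases[of i] S.sg_cases[of j] S.dom[OF ije(4)] by (auto simp: d_def)
    moreover have "d = 1" if "\<not> unb k"
    proof -
      have "S.balanced i" using unb[of k a] that ka x_n by (simp add: S.balanced_def)
      then show ?thesis using S.sign_eq[OF ije(4)] by (simp add: d_def mult.assoc)
    qed
    moreover have "H = {w \<in> W. w (k, a) = d * w (k, b)}"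
      using im1[of k a b e] ka lb kl H by (simp add: d_def)
    ultimately show "H \<in> P1" unfolding P1_def using ka lb kl ije(3) by blast
  next
    fix H assume "H \<in> P1"
    then obtain k a b d where h: "k < N" "a < m k" "b < m k" "a \<noteq> b" "d = 1 \<or> d = -1 \<and> unb k"
      and H: "H = {w \<in> W. w (k, a) = d * w (k, b)}" by (auto simp: P1_def)
    define e where "e = S.sg (x k a) * d * S.sg (x k b)"
    have "S (x k a) (x k b) e"
    proof (cases "d = 1")
      case True
      then show ?thesis using x_S h by (simp add: e_def)
    next
      case False
      then show ?thesis using S_unb[OF h(1-3), of e] h(5) S.sg_cases[of "x k a"] S.sg_cases[of "x k b"]
        by (auto simp: e_def)
    qed
    moreover have "H = f ` plane ?U (x k a) (x k b) e"
    proof -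
      have "S.sg (x k a) * e * S.sg (x k b) = d"
        by (simp add: e_def mult.assoc mult.commute[of d])
      then show ?thesis using im1[OF h(1-3), of e] H by simp
    qed
    moreover have "x k a \<noteq> x k b" using x_inj h by simp
    ultimately show "H \<in> (`) f ` {plane ?U i j e | i j e. i \<in> T.reps \<and> j \<in> T.reps \<and> i \<noteq> j \<and> S i j e}"
      using x_reps[OF h(1,2)] x_reps[OF h(1,3)]
      by (intro image_eqI[of _ _ "plane ?U (x k a) (x k b) e"]) blast+
  qed
  moreover have "(`) f ` {{v \<in> ?U. v i = 0} | i. i \<in> L} = P0"
  proof (intro equalityI subsetI)
    fix H assume "H \<in> (`) f ` {{v \<in> ?U. v i = 0} | i. i \<in> L}"
    then obtain i where i: "i \<in> L" "H = f ` {v \<in> ?U. v i = 0}" by blast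
    then have "i \<in> T.reps" by (simp add: L_def)
    then obtain k a where ka: "k < N" "a < m k" "i = x k a" using x_ex by blast
    then have "H = {w \<in> W. w (k, a) = 0}" using i(2) im0 by simp
    then show "H \<in> P0" unfolding P0_def using i(1) ka by blast
  next
    fix H assume "H \<in> P0"
    then obtain k a where ka: "k < N" "a < m k" "x k a \<in> L" "H = {w \<in> W. w (k, a) = 0}"
      unfolding P0_def by blast
    then have "H = f ` {v \<in> ?U. v (x k a) = 0}" using im0 by simp
    then show "H \<in> (`) f ` {{v \<in> ?U. v i = 0} | i. i \<in> L}" using ka(3) by blast
  qed
  ultimately have f_H: "(`) f ` \<H> = P1 \<union> P0" by (simp add: H_eq image_Un)
  have snd_k: "H \<in> snd (As ! k) \<longleftrightarrow>
     (\<exists>a b d. a < m k \<and> b < m k \<and> a \<noteq> b \<and> (d = 1 \<or> d = -1 \<and> unb k) \<and> H = {z \<in> Cn (m k). z a = d * z b}) \<or>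
     (\<exists>a. a < m k \<and> x k a \<in> L \<and> H = {z \<in> Cn (m k). z a = 0})" (is "_ \<longleftrightarrow> ?D \<or> ?Z") if k: "k < N" for k H
  proof -
    have D: "?D \<longleftrightarrow> H \<in> difference_planes (m k) \<or> unb k \<and> H \<in> sum_planes (m k)"
      unfolding difference_planes_def sum_planes_def by (fastforce simp: add_eq_0_iff2)
    have Z: "?Z \<longleftrightarrow> unb k \<and> (\<exists>a<r k. H = {z \<in> Cn (m k). z a = 0})"
    proof -
      have "(a < m k \<and> x k a \<in> L) \<longleftrightarrow> (unb k \<and> a < r k)" for a
        using x_L[OF k, of a] no_L[OF k, of a] rm[OF k] by auto
      then show ?thesis unfolding conj_assoc[symmetric] by blast
    qed
    show ?thesis unfolding D Z using rm[OF k]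
      by (auto simp: As_k[OF k] type_BCD_def type_A_def)
  qed
  have row_plane: "{w \<in> W. (\<lambda>i. w (k, i)) \<in> {z \<in> Cn (m k). P z}} = {w \<in> W. P (\<lambda>i. w (k, i))}"
    if "k < N" for k P
    using row that by auto
  have "snd (direct_sum As) = {{w \<in> W. (\<lambda>i. w (k, i)) \<in> H} | k H. k < N \<and> H \<in> snd (As ! k)}"
    by (simp add: direct_sum_def Let_def W len)
  also have "\<dots> = P1 \<union> P0"
  proof (intro equalityI subsetI)
    fix G assume "G \<in> {{w \<in> W. (\<lambda>i. w (k, i)) \<in> H} | k H. k < N \<and> H \<in> snd (As ! k)}"
    then obtain k H where k: "k < N" and H: "H \<in> snd (As ! k)" and G: "G = {w \<in> W. (\<lambda>i. w (k, i)) \<in> H}"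
      by blast
    consider a b d where "H = {z \<in> Cn (m k). z a = d * z b}"
        "a < m k" "b < m k" "a \<noteq> b" "d = 1 \<or> d = -1 \<and> unb k"
      | a where "H = {z \<in> Cn (m k). z a = 0}" "a < m k" "x k a \<in> L"
      using H[unfolded snd_k[OF k]] by blast
    then show "G \<in> P1 \<union> P0"
    proof cases
      case (1 a b d)
      then have "G = {w \<in> W. w (k, a) = d * w (k, b)}" using G row_plane[OF k] by simp
      then show ?thesis using 1(2-5) k unfolding P1_def by blast
    next
      case (2 a)
      then have "G = {w \<in> W. w (k, a) = 0}" using G row_plane[OF k] by simp
      then show ?thesis using 2(2,3) k unfolding P0_def by blast
    qed
  next
    fix G assume "G \<in> P1 \<union> P0"
    then obtain k H where k: "k < N" and H: "H \<in> snd (As ! k)" and G: "G = {w \<in> W. (\<lambda>i. w (k, i)) \<in> H}"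
    proof
      assume "G \<in> P1"
      then obtain k a b d where h: "k < N" "a < m k" "b < m k" "a \<noteq> b" "d = 1 \<or> d = -1 \<and> unb k"
        and G: "G = {w \<in> W. w (k, a) = d * w (k, b)}" unfolding P1_def by blast
      have "{z \<in> Cn (m k). z a = d * z b} \<in> snd (As ! k)"
        unfolding snd_k[OF h(1)] using h by blast
      then show ?thesis using that[OF h(1)] G row_plane[OF h(1), of "\<lambda>z. z a = d * z b"] by simp
    next
      assume "G \<in> P0"
      then obtain k a where h: "k < N" "a < m k" "x k a \<in> L"
        and G: "G = {w \<in> W. w (k, a) = 0}" unfolding P0_def by blast
      have "{z \<in> Cn (m k). z a = 0} \<in> snd (As ! k)"
        unfolding snd_k[OF h(1)] using h by blast
      then show ?thesis using that[OF h(1)] G row_plane[OF h(1), of "\<lambda>z. z a = 0"] by simp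
    qed
    then show "G \<in> {{w \<in> W. (\<lambda>i. w (k, i)) \<in> H} | k H. k < N \<and> H \<in> snd (As ! k)}" by blast
  qed
  finally have snd_sum: "snd (direct_sum As) = P1 \<union> P0" .
  have "isomorphic_arrangements (?U, \<H>) (direct_sum As)"
    unfolding isomorphic_arrangements_def
    using iso f_H snd_sum by (auto simp: direct_sum_def Let_def W intro!: exI[of _ f])
  moreover have "classical_type A \<or> exotic_type n A" if A: "A \<in> set As" for A
  proof -
    obtain k where k: "k < N" "A = As ! k" using A by (metis in_set_conv_nth len)
    have "m k \<le> n"
    proof -
      have "set (xss ! k) \<subseteq> {..<n}" using k(1) xss(1) T.reps_less by (fastforce simp: N_def)
      then have "card (set (xss ! k)) \<le> n" using card_mono[of "{..<n}" "set (xss ! k)"] by simp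
      then show ?thesis using xss(2)[of "xss ! k"] k(1) by (simp add: N_def m_def distinct_card)
    qed
    then show ?thesis
    proof (cases "unb k")
      case True
      then have "A = type_BCD (r k) (m k - r k)" using k As_k by simp
      moreover have "r k + (m k - r k) \<le> n" using \<open>m k \<le> n\<close> rm k by simp
      ultimately show ?thesis unfolding exotic_type_def by blast
    next
      case False
      then have "A = type_A (m k)" using k As_k by simp
      then show ?thesis using m_pos[OF k(1)] unfolding classical_type_def
        by (intro disjI1 exI[of _ "m k"]) auto
    qed
  qed
  ultimately show ?thesis by blast
qed

end

section \<open>The signed equivalence relation of a root subsystem\<close>

definition linked :: "nat \<Rightarrow> ((nat \<Rightarrow> complex) \<Rightarrow> complex) set \<Rightarrow> nat \<Rightarrow> nat \<Rightarrow> complex \<Rightarrow> bool"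
  where "linked n \<Phi> i j e \<longleftrightarrow> i < n \<and> j < n \<and> i \<noteq> j \<and> (e = 1 \<or> e = -1) \<and>
    dual_basis n i - e *\<^sub>F dual_basis n j \<in> \<Phi>"

definition looped :: "nat \<Rightarrow> ((nat \<Rightarrow> complex) \<Rightarrow> complex) set \<Rightarrow> nat \<Rightarrow> bool"
  where "looped n \<Phi> i \<longleftrightarrow> i < n \<and> (\<exists>c\<in>{1, -1, 2, -2}. c *\<^sub>F dual_basis n i \<in> \<Phi>)"

text \<open>
  On the diagonal, \<open>e = -1\<close> stands for the equation \<open>v\<^sub>i = 0\<close>. It is included when it follows
  from the roots of \<open>\<Phi>\<close>, even if no multiple of \<open>\<alpha>\<^sub>i\<close> is itself a root.
\<close>

definition tied :: "nat \<Rightarrow> ((nat \<Rightarrow> complex) \<Rightarrow> complex) set \<Rightarrow> nat \<Rightarrow> nat \<Rightarrow> complex \<Rightarrow> bool"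
  where "tied n \<Phi> i j e \<longleftrightarrow> linked n \<Phi> i j e \<or> i < n \<and> i = j \<and>
    (e = 1 \<or> e = -1 \<and> (looped n \<Phi> i \<or> (\<exists>k. linked n \<Phi> i k 1 \<and> linked n \<Phi> i k (-1))))"

lemma dual_basis_std_basis: "i < n \<Longrightarrow> dual_basis n i (std_basis j) = (if j = i \<and> j < n then 1 else 0)"
  by (auto simp: dual_basis_def restrict_form_def std_basis_def Cn_def)

lemma dual_basis_apply: "v \<in> Cn n \<Longrightarrow> dual_basis n i v = v i"
  by (simp add: dual_basis_def restrict_form_def)

lemma form_inner_dual_basis: "i < n \<Longrightarrow> j < n \<Longrightarrow>
    form_inner n (dual_basis n i) (dual_basis n j) = (if i = j then 1 else 0)"
proof -
  assume h: "i < n" "j < n"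
  have "form_inner n (dual_basis n i) (dual_basis n j) = (\<Sum>k<n. if k = i then (if i = j then 1 else 0) else 0)"
    unfolding form_inner_def by (rule sum.cong) (auto simp: dual_basis_std_basis h)
  then show ?thesis using h by simp
qed

lemma form_inner_linear:
  "form_inner n (f + g) h = form_inner n f h + form_inner n g h"
  "form_inner n h (f + g) = form_inner n h f + form_inner n h g"
  "form_inner n (f - g) h = form_inner n f h - form_inner n g h"
  "form_inner n h (f - g) = form_inner n h f - form_inner n h g"
  "form_inner n (c *\<^sub>F f) h = c * form_inner n f h"
  "form_inner n h (c *\<^sub>F f) = cnj c * form_inner n h f"
  by (simp_all add: form_inner_def scale_fun_def algebra_simps sum.distrib sum_subtractf sum_distrib_left)

context
  fixes n :: nat and \<Phi> :: "((nat \<Rightarrow> complex) \<Rightarrow> complex) set"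
  assumes root: "root_subsystem n \<Phi>"
begin

lemma reflection_closed: "a \<in> \<Phi> \<Longrightarrow> b \<in> \<Phi> \<Longrightarrow> reflection n a b \<in> \<Phi>"
  using root by (auto simp: root_subsystem_def)

lemma uminus_root: assumes "a \<in> \<Phi>" "form_inner n a a \<noteq> 0" shows "- a \<in> \<Phi>"
  using reflection_closed[OF assms(1,1)] assms(2)
  by (simp add: reflection_def scale_fun_def fun_diff_def fun_Compl_def)

lemma linked_uminus: "linked n \<Phi> i j e \<Longrightarrow> - (dual_basis n i - e *\<^sub>F dual_basis n j) \<in> \<Phi>"
  by (rule uminus_root) (auto simp: linked_def form_inner_linear form_inner_dual_basis)

lemma linked_sym: assumes "linked n \<Phi> i j e" shows "linked n \<Phi> j i e"
proof -
  have e: "e = 1 \<or> e = -1" using assms by (simp add: linked_def)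
  then have "dual_basis n j - e *\<^sub>F dual_basis n i \<in> \<Phi>"
  proof
    assume "e = 1"
    then have "dual_basis n j - e *\<^sub>F dual_basis n i = - (dual_basis n i - e *\<^sub>F dual_basis n j)"
      by (simp add: fun_eq_iff scale_fun_def)
    then show ?thesis using linked_uminus[OF assms] by simp
  next
    assume "e = -1"
    then have "dual_basis n j - e *\<^sub>F dual_basis n i = dual_basis n i - e *\<^sub>F dual_basis n j"
      by (simp add: fun_eq_iff scale_fun_def)
    then show ?thesis using assms by (simp add: linked_def)
  qed
  then show ?thesis using assms by (auto simp: linked_def)
qed

text \<open>
  Here \<open>\<alpha>\<^sub>i - e \<alpha>\<^sub>j\<close> and \<open>\<alpha>\<^sub>j - d \<alpha>\<^sub>k\<close> span a system of type \<open>A\<^sub>2\<close>, and the reflection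
  in the second adds \<open>e\<close> times it to the first.
\<close>

lemma linked_trans:
  assumes "linked n \<Phi> i j e" "linked n \<Phi> j k d" "i \<noteq> k"
  shows "linked n \<Phi> i k (e * d)"
proof -
  let ?a = "dual_basis n i - e *\<^sub>F dual_basis n j" and ?b = "dual_basis n j - d *\<^sub>F dual_basis n k"
  have h: "i < n" "j < n" "k < n" "i \<noteq> j" "j \<noteq> k" and ed: "e = 1 \<or> e = -1" "d = 1 \<or> d = -1"
    using assms by (auto simp: linked_def)
  have "form_inner n ?a ?b = -e" "form_inner n ?b ?b = 2"
    using h assms(3) ed by (auto simp: form_inner_linear form_inner_dual_basis)
  then have "reflection n ?b ?a = dual_basis n i - (e * d) *\<^sub>F dual_basis n k"
    by (auto simp: reflection_def fun_eq_iff scale_fun_def algebra_simps)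
  moreover have "reflection n ?b ?a \<in> \<Phi>"
    using assms reflection_closed by (simp add: linked_def)
  moreover have "e * d = 1 \<or> e * d = -1" using ed by auto
  ultimately show ?thesis using h assms(3) unfolding linked_def by simp
qed

text \<open>The reflection in a multiple of \<open>\<alpha>\<^sub>i\<close> changes the sign of \<open>\<alpha>\<^sub>i\<close>.\<close>

lemma looped_linked:
  assumes "looped n \<Phi> i" "linked n \<Phi> i j e" shows "linked n \<Phi> i j (-e)"
proof -
  obtain c where c: "c \<in> {1, -1, 2, -2}" "c *\<^sub>F dual_basis n i \<in> \<Phi>"
    using assms(1) unfolding looped_def by blast
  let ?a = "dual_basis n j - e *\<^sub>F dual_basis n i" and ?b = "c *\<^sub>F dual_basis n i"
  have l: "linked n \<Phi> j i e" using linked_sym assms by blast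
  then have h: "i < n" "j < n" "i \<noteq> j" and e: "e = 1 \<or> e = -1" by (auto simp: linked_def)
  have c': "cnj c = c" "c \<noteq> 0" using c(1) by auto
  have "form_inner n ?a ?b = -e * c" "form_inner n ?b ?b = c * c"
    using h c' by (auto simp: form_inner_linear form_inner_dual_basis)
  then have "reflection n ?b ?a = dual_basis n j - (-e) *\<^sub>F dual_basis n i"
    using c' by (auto simp: reflection_def fun_eq_iff scale_fun_def field_simps)
  moreover have "reflection n ?b ?a \<in> \<Phi>"
    using c l reflection_closed by (simp add: linked_def)
  ultimately have "linked n \<Phi> j i (-e)" using h e by (auto simp: linked_def)
  then show ?thesis using linked_sym by blast
qed

text \<open>
  If \<open>i\<close> is linked to some \<open>k \<noteq> j\<close> with both signs, then the detour from \<open>i\<close> to \<open>k\<close>, back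
  to \<open>i\<close> with the other sign and on to \<open>j\<close> has sign \<open>-e\<close>.
\<close>

lemma unbalanced_linked:
  assumes "tied n \<Phi> i i (-1)" "linked n \<Phi> i j e" shows "linked n \<Phi> i j (-e)"
proof -
  consider "looped n \<Phi> i" | k where "linked n \<Phi> i k 1" "linked n \<Phi> i k (-1)"
    using assms(1) by (auto simp: tied_def linked_def)
  then show ?thesis
  proof cases
    case 1
    then show ?thesis using assms looped_linked by blast
  next
    case (2 k)
    have e: "e = 1 \<or> e = -1" using assms(2) by (simp add: linked_def)
    show ?thesis
    proof (cases "k = j")
      case True
      then show ?thesis using 2 e by auto
    next
      case False
      have "linked n \<Phi> k j (-1 * e)"
        using linked_trans[OF linked_sym[OF 2(2)] assms(2)] False by simp
      then show ?thesis using linked_trans[OF 2(1), of j "-e"] assms(2) by (simp add: linked_def)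
    qed
  qed
qed

text \<open>
  Composing an edge with the relation of one of its ends to itself is \<open>unbalanced_linked\<close>; a path
  that goes to \<open>j\<close> and returns with the opposite sign is exactly what makes \<open>i\<close> unbalanced.
\<close>

lemma tied_trans:
  assumes "tied n \<Phi> i j e" "tied n \<Phi> j k d" shows "tied n \<Phi> i k (e * d)"
proof -
  have D: "i < n" "j < n" "k < n" "e = 1 \<or> e = -1" "d = 1 \<or> d = -1"
    using assms by (auto simp: tied_def linked_def)
  have L: "linked n \<Phi> p q s" if "tied n \<Phi> p q s" "p \<noteq> q" for p q s
    using that by (simp add: tied_def)
  have T: "tied n \<Phi> p q s" if "linked n \<Phi> p q s" for p q s
    using that by (simp add: tied_def)
  consider "i = j" "e = 1" | "j = k" "d = 1" | "i = j" "j = k" "e = -1" "d = -1"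
    | "i = j" "e = -1" "j \<noteq> k" | "i \<noteq> j" "j = k" "d = -1" | "i \<noteq> j" "j \<noteq> k" "i \<noteq> k"
    | "i \<noteq> j" "i = k" using D(4,5) by blast
  then show ?thesis
  proof cases
    case 4
    then show ?thesis using unbalanced_linked[of j k d] L assms T by auto
  next
    case 5
    then have "linked n \<Phi> j i (-e)" using unbalanced_linked[of j i e] L linked_sym assms by auto
    then show ?thesis using 5 T linked_sym by auto
  next
    case 6
    then show ?thesis using L T assms linked_trans by blast
  next
    case 7
    have l: "linked n \<Phi> i j e" "linked n \<Phi> i j d" using 7 L assms linked_sym by auto
    then show ?thesis using D(4,5) 7 D(1) by (auto simp: tied_def)
  qed (use assms D in \<open>auto simp: tied_def\<close>)
qed

lemma signed_equivalence_tied: "signed_equivalence n (tied n \<Phi>)"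
proof
  show "tied n \<Phi> i j e \<Longrightarrow> tied n \<Phi> j i e" for i j e
    using linked_sym by (auto simp: tied_def)
  show "tied n \<Phi> i j e \<Longrightarrow> tied n \<Phi> j k d \<Longrightarrow> tied n \<Phi> i k (e * d)" for i j k e d
    by (rule tied_trans)
qed (auto simp: tied_def linked_def)

lemma root_cases:
  assumes "a \<in> \<Phi>"
  obtains i j e where "linked n \<Phi> i j e" "\<And>v. v \<in> Cn n \<Longrightarrow> a v = 0 \<longleftrightarrow> v i = e * v j"
  | i where "looped n \<Phi> i" "\<And>v. v \<in> Cn n \<Longrightarrow> a v = 0 \<longleftrightarrow> v i = 0"
proof -
  have "a \<in> BC n" using assms root by (auto simp: root_subsystem_def)
  then consider c d i j where "a = c *\<^sub>F dual_basis n i + d *\<^sub>F dual_basis n j"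
      "c = 1 \<or> c = -1" "d = 1 \<or> d = -1" "i < n" "j < n" "i \<noteq> j"
    | c i where "a = c *\<^sub>F dual_basis n i" "c \<in> {1, -1, 2, -2}" "i < n"
    unfolding BC_def by blast
  then show ?thesis
  proof cases
    case (1 c d i j)
    have eq: "dual_basis n i - (-(c * d)) *\<^sub>F dual_basis n j = c *\<^sub>F a"
      using 1 by (auto simp: fun_eq_iff scale_fun_def)
    have v: "a v = c * (v i - (-(c * d)) * v j)" if "v \<in> Cn n" for v
      using that 1 by (auto simp: scale_fun_def dual_basis_apply)
    have "form_inner n a a = 2"
      using 1 by (auto simp: form_inner_linear form_inner_dual_basis)
    then have "c *\<^sub>F a \<in> \<Phi>"
      using 1(2) assms uminus_root[OF assms] by (auto simp: fun_Compl_def scale_fun_def)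
    then have "linked n \<Phi> i j (-(c * d))" using 1 eq by (auto simp: linked_def)
    moreover have "a v = 0 \<longleftrightarrow> v i = -(c * d) * v j" if "v \<in> Cn n" for v
      using v[OF that] 1(2) by (auto simp: add_eq_0_iff2)
    ultimately show ?thesis using that(1) by blast
  next
    case (2 c i)
    then have "looped n \<Phi> i" using assms by (auto simp: looped_def)
    moreover have "a v = 0 \<longleftrightarrow> v i = 0" if "v \<in> Cn n" for v
      using that 2 by (auto simp: scale_fun_def dual_basis_apply)
    ultimately show ?thesis using that(2) by blast
  qed
qed

lemma root_tied:
  assumes "a \<in> \<Phi>"
  obtains i j e where "tied n \<Phi> i j e" "\<And>v. v \<in> Cn n \<Longrightarrow> a v = 0 \<longleftrightarrow> v i = e * v j"
  using assms
proof (cases rule: root_cases)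
  case (1 i j e)
  then have "tied n \<Phi> i j e" by (simp add: tied_def)
  then show ?thesis using that 1(2) by blast
next
  case (2 i)
  then have "tied n \<Phi> i i (-1)" by (simp add: tied_def looped_def)
  moreover have "a v = 0 \<longleftrightarrow> v i = -1 * v i" if "v \<in> Cn n" for v
    using 2(2)[OF that] by auto
  ultimately show ?thesis using that by blast
qed

lemma common_kernel_eq_invariants:
  "common_kernel n \<Phi> = signed_equivalence.invariants n (tied n \<Phi>)"
proof (intro equalityI subsetI)
  fix v assume v: "v \<in> common_kernel n \<Phi>"
  have zero: "a v = 0" if "a \<in> \<Phi>" for a
    using v that by (auto simp: common_kernel_def Ker_def)
  have Cn: "v \<in> Cn n" using v by (simp add: common_kernel_def)
  have link: "v i = e * v j" if "linked n \<Phi> i j e" for i j e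
    using zero[of "dual_basis n i - e *\<^sub>F dual_basis n j"] that Cn
    by (simp add: linked_def scale_fun_def dual_basis_apply)
  have loop: "v i = 0" if "looped n \<Phi> i" for i
    using that zero Cn unfolding looped_def by (fastforce simp: scale_fun_def dual_basis_apply)
  have "v i = e * v j" if tied: "tied n \<Phi> i j e" for i j e
  proof -
    consider "linked n \<Phi> i j e" | "i = j" "e = 1" | "i = j" "looped n \<Phi> i"
      | k where "i = j" "linked n \<Phi> i k 1" "linked n \<Phi> i k (-1)"
      using tied unfolding tied_def by blast
    then show ?thesis
    proof cases
      case 4
      then have "v i = 0" using link[OF 4(2)] link[OF 4(3)] by simp
      then show ?thesis using 4(1) by simp
    qed (use link loop in auto)
  qed
  then show "v \<in> signed_equivalence.invariants n (tied n \<Phi>)"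
    using Cn unfolding signed_equivalence.invariants_def[OF signed_equivalence_tied] by blast
next
  fix v assume v: "v \<in> signed_equivalence.invariants n (tied n \<Phi>)"
  then have Cn: "v \<in> Cn n" and tie: "\<And>i j e. tied n \<Phi> i j e \<Longrightarrow> v i = e * v j"
    unfolding signed_equivalence.invariants_def[OF signed_equivalence_tied] by blast+
  have "a v = 0" if "a \<in> \<Phi>" for a
    using root_tied[OF that] tie Cn by metis
  then show "v \<in> common_kernel n \<Phi>" using Cn by (simp add: common_kernel_def Ker_def)
qed

end

lemma root_linear:
  assumes "a \<in> BC n"
  shows "u \<in> Cn n \<Longrightarrow> v \<in> Cn n \<Longrightarrow> a (u + v) = a u + a v"
    and "v \<in> Cn n \<Longrightarrow> a (c *\<^sub>F v) = c * a v"
proof -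
  have add: "u + v \<in> Cn n" if "u \<in> Cn n" "v \<in> Cn n" for u v
    using that by (simp add: Cn_def)
  have scale: "c *\<^sub>F v \<in> Cn n" if "v \<in> Cn n" for c v
    using that by (simp add: Cn_def scale_fun_def)
  show "u \<in> Cn n \<Longrightarrow> v \<in> Cn n \<Longrightarrow> a (u + v) = a u + a v"
    using assms add[of u v] unfolding BC_def
    by (auto simp: scale_fun_def dual_basis_apply algebra_simps)
  show "v \<in> Cn n \<Longrightarrow> a (c *\<^sub>F v) = c * a v"
    using assms scale[of v c] unfolding BC_def
    by (auto simp: dual_basis_apply) (auto simp: scale_fun_def dual_basis_apply algebra_simps)
qed

lemma finite_BC: "finite (BC n)"
proof -
  have "BC n \<subseteq> (\<lambda>(a, b, i, j). a *\<^sub>F dual_basis n i + b *\<^sub>F dual_basis n j) `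
      ({1, -1} \<times> {1, -1} \<times> {..<n} \<times> {..<n}) \<union>
    (\<lambda>(a, i). a *\<^sub>F dual_basis n i) ` ({1, -1, 2, -2} \<times> {..<n})"
    unfolding BC_def by (intro Un_mono subsetI) (force simp: image_iff)+
  then show ?thesis by (rule finite_subset) simp
qed

lemma Cn_subset_span: "Cn n \<subseteq> fun_vs.span (std_basis ` {..<n})"
proof
  fix v assume v: "v \<in> Cn n"
  have "v = (\<Sum>i<n. v i *\<^sub>F std_basis i)"
  proof
    fix j
    have "(\<Sum>i<n. v i *\<^sub>F std_basis i) j = (\<Sum>i<n. if j = i then v i else 0)"
      unfolding scale_fun_def std_basis_def by (induction n) auto
    also have "\<dots> = v j" using v by (simp add: Cn_def)
    finally show "v j = (\<Sum>i<n. v i *\<^sub>F std_basis i) j" by simp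
  qed
  moreover have "(\<Sum>i<n. v i *\<^sub>F std_basis i) \<in> fun_vs.span (std_basis ` {..<n})"
    by (intro fun_vs.span_sum fun_vs.span_scale fun_vs.span_base) auto
  ultimately show "v \<in> fun_vs.span (std_basis ` {..<n})" by simp
qed

text \<open>A maximal independent subset is finite because it lies in the span of \<open>n\<close> vectors.\<close>

lemma subspace_Cn_finite_spanning_set:
  assumes "fun_vs.subspace U" "U \<subseteq> Cn n"
  shows "\<exists>B. finite B \<and> fun_vs.span B = U"
proof -
  obtain B where B: "B \<subseteq> U" "fun_vs.independent B" "U \<subseteq> fun_vs.span B"
    using fun_vs.maximal_independent_subset by metis
  have "B \<subseteq> fun_vs.span (std_basis ` {..<n})" using B(1) assms(2) Cn_subset_span by blast
  then have "finite B" using fun_vs.independent_span_bound[OF _ B(2)] by blast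
  moreover have "fun_vs.span B = U"
    using B fun_vs.span_minimal[OF B(1) assms(1)] by blast
  ultimately show ?thesis by blast
qed

lemma hyperplane_arrangement_restricted:
  assumes "\<Phi> \<subseteq> BC n" "fun_vs.subspace (common_kernel n \<Phi>')"
  shows "hyperplane_arrangement (restricted_arrangement n \<Phi> \<Phi>')"
proof -
  let ?U = "common_kernel n \<Phi>'"
  have U: "?U \<subseteq> Cn n" by (auto simp: common_kernel_def)
  have form: "restrict_form a ?U \<in> dual_space ?U" if "a \<in> \<Phi>" for a
  proof -
    have a: "a \<in> BC n" using that assms(1) by blast
    show ?thesis
      using U root_linear[OF a] fun_vs.subspace_add[OF assms(2)] fun_vs.subspace_scale[OF assms(2)]
      unfolding dual_space_def restrict_form_def by (auto simp: subset_iff)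
  qed
  have "finite \<Phi>" using assms(1) finite_BC finite_subset by blast
  then have "finite {Ker ?U (restrict_form a ?U) | a. a \<in> \<Phi> - \<Phi>' \<and> restrict_form a ?U \<noteq> 0}"
    by simp
  then show ?thesis
    using assms(2) subspace_Cn_finite_spanning_set[OF assms(2) U] form
    unfolding hyperplane_arrangement_def restricted_arrangement_def Let_def by fastforce
qed

theorem theorem7p4p5:
  fixes n :: nat and \<Phi> \<Phi>' :: "((nat \<Rightarrow> complex) \<Rightarrow> complex) set"
  assumes "root_subsystem n \<Phi>" and "root_subsystem n \<Phi>'" and "\<Phi>' \<subseteq> \<Phi>"
  shows "hyperplane_arrangement (restricted_arrangement n \<Phi> \<Phi>') \<and>
    (\<exists>As. (\<forall>A\<in>set As. classical_type A \<or> exotic_type n A) \<and>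
          isomorphic_arrangements (restricted_arrangement n \<Phi> \<Phi>') (direct_sum As))"
proof -
  interpret nested_signed_equivalences n "tied n \<Phi>" "tied n \<Phi>'"
  proof (intro nested_signed_equivalences.intro nested_signed_equivalences_axioms.intro)
    show "tied n \<Phi> i j e" if "tied n \<Phi>' i j e" for i j e
      using that assms(3) by (auto simp: tied_def linked_def looped_def)
  qed (use assms signed_equivalence_tied in auto)
  have U: "common_kernel n \<Phi>' = T.invariants"
    by (rule common_kernel_eq_invariants[OF assms(2)])
  have U_Cn: "v \<in> Cn n" if "v \<in> T.invariants" for v
    using that U by (auto simp: common_kernel_def)
  \<comment> \<open>A form vanishes on \<open>U\<close> exactly if its kernel is all of \<open>U\<close>, so the forms that the
      arrangement leaves out can be recognised from their kernels.\<close>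
  have vanish: "restrict_form a T.invariants \<noteq> 0 \<longleftrightarrow> Ker T.invariants (restrict_form a T.invariants) \<noteq> T.invariants"
    for a by (auto simp: restrict_form_def Ker_def fun_eq_iff)
  define \<H> where "\<H> = snd (restricted_arrangement n \<Phi> \<Phi>')"
  have H: "\<H> = {Ker T.invariants (restrict_form a T.invariants) | a. a \<in> \<Phi> - \<Phi>' \<and> restrict_form a T.invariants \<noteq> 0}"
    by (simp add: \<H>_def restricted_arrangement_def U Let_def)
  have "\<exists>As. (\<forall>A\<in>set As. classical_type A \<or> exotic_type n A) \<and>
    isomorphic_arrangements (T.invariants, \<H>) (direct_sum As)"
  proof (rule arrangement_isomorphic_direct_sum)
    fix H assume "H \<in> \<H>"
    then obtain a where a: "a \<in> \<Phi>" "H = Ker T.invariants (restrict_form a T.invariants)"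
      "H \<noteq> T.invariants" using H vanish by auto
    obtain i j e where "tied n \<Phi> i j e" "\<And>v. v \<in> Cn n \<Longrightarrow> a v = 0 \<longleftrightarrow> v i = e * v j"
      using root_tied[OF assms(1) a(1)] by blast
    moreover from this have "H = plane T.invariants i j e"
      using a(2) U_Cn by (auto simp: plane_def Ker_def restrict_form_def)
    ultimately show "\<exists>i j e. tied n \<Phi> i j e \<and> H = plane T.invariants i j e \<and> H \<noteq> T.invariants"
      using a(3) by blast
  next
    fix i j e assume h: "tied n \<Phi> i j e" "i \<noteq> j" "plane T.invariants i j e \<noteq> T.invariants"
    let ?a = "dual_basis n i - e *\<^sub>F dual_basis n j"
    have a: "?a \<in> \<Phi>" using h by (simp add: tied_def linked_def)
    have P: "Ker T.invariants (restrict_form ?a T.invariants) = plane T.invariants i j e"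
      using U_Cn by (auto simp: plane_def Ker_def restrict_form_def scale_fun_def dual_basis_apply)
    then have "restrict_form ?a T.invariants \<noteq> 0" using h(3) vanish by simp
    moreover have "?a \<notin> \<Phi>'"
    proof
      assume "?a \<in> \<Phi>'"
      then have "restrict_form ?a T.invariants = 0"
        unfolding U[symmetric] by (auto simp: common_kernel_def Ker_def restrict_form_def fun_eq_iff)
      then show False using calculation by simp
    qed
    ultimately show "plane T.invariants i j e \<in> \<H>" using a P H by blast
  qed
  moreover have "restricted_arrangement n \<Phi> \<Phi>' = (T.invariants, \<H>)"
    by (simp add: \<H>_def restricted_arrangement_def U Let_def)
  moreover have "hyperplane_arrangement (restricted_arrangement n \<Phi> \<Phi>')"
    using assms(1) T.subspace_invariants
    by (intro hyperplane_arrangement_restricted) (auto simp: root_subsystem_def U)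
  ultimately show ?thesis by simp
qed

end
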